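(* Let $d=4$, $R>1$ and $s<0$. The problem $$\begin{cases}\Delta v=v^2 & \text{in } B(R)\setminus\overline{B(1)},\\ v=s&\text{on }\partial B(1),\\ v=0&\text{on }\partial B(R),\\ |\partial v/\partial n|<R^{-3}&\text{on }\partial B(R)\end{cases}$$ has at most one rotationally invariant solution $v$.
   Context: $B(r)$ denotes the open ball of radius $r$ centred at the origin in $\mathbb{R}^4$, and $\partial v/\partial n$ is the normal derivative on the sphere $\partial B(R)$. A solution is a function on the closed annulus that satisfies the PDE in the interior, extends continuously to the closure, and satisfies the boundary conditions. *)

theory Defs
  imports "HOL-Analysis.Analysis"
begin

definition partial_deriv :: "'a::euclidean_space \<Rightarrow> ('a \<Rightarrow> real) \<Rightarrow> 'a \<Rightarrow> real" where
  "partial_deriv b f x = deriv (\<lambda>t. f (x + t *\<^sub>R b)) 0"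

text \<open>Since \<^const>\<open>deriv\<close> is total, differentiability is required separately.
  Both notions below are meant for open sets \<open>S\<close>.\<close>

definition C1_on :: "('a::euclidean_space \<Rightarrow> real) \<Rightarrow> 'a set \<Rightarrow> bool" where
  "C1_on f S \<longleftrightarrow> continuous_on S f \<and>
     (\<forall>b\<in>Basis. (\<forall>x\<in>S. (\<lambda>t. f (x + t *\<^sub>R b)) differentiable (at 0)) \<and>
                 continuous_on S (partial_deriv b f))"

definition C2_on :: "('a::euclidean_space \<Rightarrow> real) \<Rightarrow> 'a set \<Rightarrow> bool" where
  "C2_on f S \<longleftrightarrow> C1_on f S \<and> (\<forall>b\<in>Basis. C1_on (partial_deriv b f) S)"

definition laplacian :: "('a::euclidean_space \<Rightarrow> real) \<Rightarrow> 'a \<Rightarrow> real" where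
  "laplacian f x = (\<Sum>b\<in>Basis. partial_deriv b (partial_deriv b f) x)"

definition open_annulus :: "real \<Rightarrow> (real^4) set" where
  "open_annulus R = ball 0 R - closure (ball 0 1)"

definition closed_annulus :: "real \<Rightarrow> (real^4) set" where
  "closed_annulus R = closure (open_annulus R)"

text \<open>The outer unit normal of the sphere of radius \<open>norm x\<close> about the origin at \<open>x\<close>
  is \<open>sgn x = x /\<^sub>R norm x\<close>. On the outer boundary of the annulus the derivative
  can only be taken from inside, hence the left-sided filter.\<close>

definition has_normal_derivative :: "('a::real_normed_vector \<Rightarrow> real) \<Rightarrow> real \<Rightarrow> 'a \<Rightarrow> bool" where
  "has_normal_derivative v D x \<longleftrightarrow>
     ((\<lambda>t. v (x + t *\<^sub>R sgn x)) has_real_derivative D) (at_left 0)"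

text \<open>Solutions are functions on the closed annulus; values elsewhere are irrelevant.\<close>

definition is_solution :: "real \<Rightarrow> real \<Rightarrow> (real^4 \<Rightarrow> real) \<Rightarrow> bool" where
  "is_solution R s v \<longleftrightarrow>
     continuous_on (closed_annulus R) v \<and>
     C2_on v (open_annulus R) \<and>
     (\<forall>x\<in>open_annulus R. laplacian v x = (v x)\<^sup>2) \<and>
     (\<forall>x\<in>sphere 0 1. v x = s) \<and>
     (\<forall>x\<in>sphere 0 R. v x = 0) \<and>
     (\<forall>x\<in>sphere 0 R. \<exists>D. has_normal_derivative v D x \<and> \<bar>D\<bar> < 1 / R ^ 3)"

definition rotationally_invariant_on :: "(real^'n \<Rightarrow> real) \<Rightarrow> (real^'n) set \<Rightarrow> bool" where
  "rotationally_invariant_on v S \<longleftrightarrow>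
     (\<forall>Q. rotation_matrix Q \<longrightarrow> (\<forall>x\<in>S. v (Q *v x) = v x))"

end

theory Submission
  imports Defs
begin

text \<open>Write \<open>v x = f (norm x)\<close>. Then \<open>(r\<^sup>3 f')' = r\<^sup>3 f\<^sup>2 \<ge> 0\<close>, so the bound on
  the normal derivative at the outer boundary propagates inwards to \<open>r\<^sup>3 f' < 1\<close>, which
  integrates to \<open>f > - 1 / (2 r\<^sup>2)\<close>. For two solutions \<open>f\<^sub>1\<close>, \<open>f\<^sub>2\<close> the function
  \<open>g = r (f\<^sub>1 - f\<^sub>2)\<close> vanishes at both ends and satisfies
  \<open>g'' + g' / r = (1 / r\<^sup>2 + f\<^sub>1 + f\<^sub>2) g\<close>. The lower bound makes the coefficient on the
  right positive (this is the critical Hardy weight), so the maximum principle gives \<open>g = 0\<close>.\<close>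

section \<open>Derivatives of radial functions and the radial Laplacian\<close>

lemma has_real_derivative_norm_line:
  fixes x b :: "'a::real_inner"
  assumes "x \<noteq> 0"
  shows "((\<lambda>t. norm (x + t *\<^sub>R b)) has_real_derivative (x \<bullet> b) / norm x) (at 0)"
proof -
  have "((\<lambda>t. norm (x + t *\<^sub>R b)) has_derivative (\<lambda>h. (h *\<^sub>R b) \<bullet> sgn (x + 0 *\<^sub>R b))) (at 0)"
    by (rule has_derivative_compose[where g = norm and f = "\<lambda>t. x + t *\<^sub>R b", OF _ has_derivative_norm])
      (use assms in \<open>auto intro!: derivative_eq_intros\<close>)
  moreover have "(\<lambda>h. (h *\<^sub>R b) \<bullet> sgn (x + 0 *\<^sub>R b)) = (*) ((x \<bullet> b) / norm x)"
    by (simp add: fun_eq_iff sgn_div_norm inner_commute divide_inverse)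
  ultimately show ?thesis
    by (simp add: has_field_derivative_def)
qed

text \<open>Lets a formula valid only on \<open>S\<close> be substituted under a derivative along a
  line. The filter is \<open>nhds 0\<close>, as \<open>DERIV_cong_ev\<close> asks for agreement at 0
  as well.\<close>

lemma eventually_line_in_open:
  fixes x b :: "'a::real_normed_vector"
  assumes "open S" "x \<in> S"
  shows "eventually (\<lambda>t::real. x + t *\<^sub>R b \<in> S) (nhds 0)"
proof -
  have "((\<lambda>t::real. x + t *\<^sub>R b) \<longlongrightarrow> x + 0 *\<^sub>R b) (nhds 0)"
    by (intro tendsto_intros filterlim_ident)
  then show ?thesis
    using assms by (simp add: topological_tendstoD)
qed

lemma has_partial_deriv_radial:
  fixes v :: "'a::euclidean_space \<Rightarrow> real"
  assumes "open S" "x \<in> S" "x \<noteq> 0"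
    and v: "\<And>y. y \<in> S \<Longrightarrow> v y = f (norm y)"
    and f: "(f has_real_derivative c) (at (norm x))"
  shows "((\<lambda>t. v (x + t *\<^sub>R b)) has_real_derivative c * ((x \<bullet> b) / norm x)) (at 0)"
proof -
  have "((\<lambda>t. f (norm (x + t *\<^sub>R b))) has_real_derivative c * ((x \<bullet> b) / norm x)) (at 0)"
    by (rule DERIV_chain2[OF _ has_real_derivative_norm_line[OF \<open>x \<noteq> 0\<close>]]) (use f in simp)
  moreover have "eventually (\<lambda>t. v (x + t *\<^sub>R b) = f (norm (x + t *\<^sub>R b))) (nhds 0)"
    using eventually_line_in_open[OF assms(1,2)] by (rule eventually_mono) (rule v)
  ultimately show ?thesis
    by (subst DERIV_cong_ev[OF refl _ refl]) auto
qed

text \<open>With \<open>h r = f' r / r\<close>, the first partials are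
  \<open>h (norm y) * (y \<bullet> b)\<close>, so the product rule gives the second ones. Summing
  over the basis, the squares add up to \<open>\<rho>\<^sup>2\<close>, leaving
  \<open>h' * \<rho> + DIM('a) * h \<rho>\<close>. By the quotient rule
  \<open>h' * \<rho> = c - h \<rho>\<close>, which lowers the factor of \<open>h \<rho>\<close> by
  one.\<close>

lemma laplacian_radial:
  fixes v :: "'a::euclidean_space \<Rightarrow> real"
  assumes S: "open S" "x \<in> S" "0 \<notin> S"
    and v: "\<And>y. y \<in> S \<Longrightarrow> v y = f (norm y)"
    and f: "\<And>y. y \<in> S \<Longrightarrow> (f has_real_derivative f' (norm y)) (at (norm y))"
    and f': "(f' has_real_derivative c) (at (norm x))"
  shows "laplacian v x = c + (DIM('a) - 1) / norm x * f' (norm x)"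
proof -
  define \<rho> where "\<rho> = norm x"
  define h where "h r = f' r / r" for r
  have "x \<noteq> 0" using S by auto
  then have \<rho>: "\<rho> > 0" by (simp add: \<rho>_def)
  have pd: "partial_deriv b v y = h (norm y) * (y \<bullet> b)" if "y \<in> S" for y b
  proof -
    have "y \<noteq> 0" using S that by auto
    with has_partial_deriv_radial[OF S(1) that _ v f[OF that]] show ?thesis
      unfolding partial_deriv_def h_def by (metis DERIV_imp_deriv times_divide_eq_left times_divide_eq_right)
  qed
  define h' where "h' = (c - f' \<rho> / \<rho>) / \<rho>"
  have h: "(h has_real_derivative h') (at \<rho>)"
    unfolding h_def h'_def using f' \<rho>
    by (auto intro!: derivative_eq_intros simp: \<rho>_def[symmetric] field_simps)
  have second: "partial_deriv b (partial_deriv b v) x = h' / \<rho> * (x \<bullet> b)\<^sup>2 + h \<rho>"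
    if "b \<in> Basis" for b
  proof -
    have "((\<lambda>t. h (norm (x + t *\<^sub>R b))) has_real_derivative h' * ((x \<bullet> b) / norm x)) (at 0)"
      by (rule has_partial_deriv_radial[OF S(1,2) \<open>x \<noteq> 0\<close> _ h[unfolded \<rho>_def]]) simp
    then have "((\<lambda>t. h (norm (x + t *\<^sub>R b)) * ((x + t *\<^sub>R b) \<bullet> b)) has_real_derivative
        h' / \<rho> * (x \<bullet> b)\<^sup>2 + h \<rho>) (at 0)"
      using that
      by (auto intro!: derivative_eq_intros
          simp: inner_add_left power2_eq_square \<rho>_def)
    moreover have "eventually (\<lambda>t. partial_deriv b v (x + t *\<^sub>R b) =
        h (norm (x + t *\<^sub>R b)) * ((x + t *\<^sub>R b) \<bullet> b)) (nhds 0)"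
      using eventually_line_in_open[OF S(1,2)] by (rule eventually_mono) (rule pd)
    ultimately have "((\<lambda>t. partial_deriv b v (x + t *\<^sub>R b)) has_real_derivative
        h' / \<rho> * (x \<bullet> b)\<^sup>2 + h \<rho>) (at 0)"
      by (subst DERIV_cong_ev[OF refl _ refl]) auto
    then show ?thesis
      unfolding partial_deriv_def[of b "partial_deriv b v"] by (rule DERIV_imp_deriv)
  qed
  have "laplacian v x = h' / \<rho> * (\<Sum>b\<in>Basis. (x \<bullet> b)\<^sup>2) + DIM('a) * h \<rho>"
    by (simp add: laplacian_def second sum.distrib sum_distrib_left)
  also have "(\<Sum>b\<in>Basis. (x \<bullet> b)\<^sup>2) = \<rho>\<^sup>2"
    unfolding \<rho>_def power2_norm_eq_inner
    by (subst euclidean_inner) (simp add: power2_eq_square)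
  also have "h' / \<rho> * \<rho>\<^sup>2 = c - f' \<rho> / \<rho>"
    using \<rho> by (simp add: h'_def power2_eq_square)
  finally show ?thesis
    using \<rho> by (simp add: h_def \<rho>_def[symmetric] diff_divide_distrib of_nat_diff left_diff_distrib)
qed

section \<open>The boundary value problem for radial profiles\<close>

text \<open>The equation is the four-dimensional radial form f'' + (3/r) f' = f^2, written as a
  first-order system on the open interval. At \<open>R\<close> only a one-sided derivative is asked
  for, and it is not linked to the limit of \<open>f'\<close>.\<close>

definition radial_solution :: "real \<Rightarrow> real \<Rightarrow> (real \<Rightarrow> real) \<Rightarrow> bool" where
  "radial_solution R s f \<longleftrightarrow>
     continuous_on {1..R} f \<and> f 1 = s \<and> f R = 0 \<and>
     (\<exists>f'. (\<forall>r\<in>{1<..<R}. (f has_real_derivative f' r) (at r) \<and>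
                         (f' has_real_derivative (f r)\<^sup>2 - 3 / r * f' r) (at r))) \<and>
     (\<exists>D. (f has_real_derivative D) (at_left R) \<and> \<bar>D\<bar> < 1 / R ^ 3)"

lemma radial_solution_lower_bound:
  assumes "radial_solution R s f" and r: "r \<in> {1<..<R}"
  shows "- 1 / (2 * r\<^sup>2) < f r"
proof -
  obtain f' D where cont: "continuous_on {1..R} f" and fR: "f R = 0"
    and f': "\<And>r. r \<in> {1<..<R} \<Longrightarrow> (f has_real_derivative f' r) (at r)"
    and f'': "\<And>r. r \<in> {1<..<R} \<Longrightarrow> (f' has_real_derivative (f r)\<^sup>2 - 3 / r * f' r) (at r)"
    and D: "(f has_real_derivative D) (at_left R)" and D_less: "D < 1 / R ^ 3"
    using assms(1) unfolding radial_solution_def by (metis abs_less_iff)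
  \<comment> \<open>The subtracted function (1/R^2 - 1/r^2)/2 is radially harmonic in dimension 4,
    vanishes at \<open>R\<close> and has slope R^(-3) there. Hence \<open>h R = 0\<close>, and h'
    has the sign of r^3 f' - 1.\<close>
  define h where "h r = f r + (1 / r\<^sup>2 - 1 / R\<^sup>2) / 2" for r
  have h': "(h has_real_derivative f' r - 1 / r ^ 3) (at r)" if "r \<in> {1<..<R}" for r
    unfolding h_def using that
    by (auto intro!: derivative_eq_intros f' simp: field_simps power2_eq_square power3_eq_cube)
  have h_cont: "continuous_on {a..R} h" if "a > 1" for a
    unfolding h_def using that
    by (intro continuous_intros continuous_on_subset[OF cont]) auto
  have mono: "a ^ 3 * f' a \<le> b ^ 3 * f' b" if "1 < a" "a \<le> b" "b < R" for a b
  proof (rule DERIV_nonneg_imp_nondecreasing[OF \<open>a \<le> b\<close>])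
    fix x assume "a \<le> x" "x \<le> b"
    with that have "x \<in> {1<..<R}" "x > 0" by auto
    then have "((\<lambda>r. r ^ 3 * f' r) has_real_derivative x ^ 3 * (f x)\<^sup>2) (at x)"
      by (auto intro!: derivative_eq_intros f''
          simp: field_simps power2_eq_square power3_eq_cube)
    with \<open>x > 0\<close> show "\<exists>y. ((\<lambda>r. r ^ 3 * f' r) has_real_derivative y) (at x) \<and> 0 \<le> y"
      by (intro exI conjI) auto
  qed
  \<comment> \<open>If the flux reached 1 at \<open>a\<close>, it would stay at least 1 up to
    \<open>R\<close>, so \<open>h\<close> would be nondecreasing on [a, R]. But the left derivative
    of \<open>h\<close> at \<open>R\<close> is negative, so \<open>h\<close> exceeds
    \<open>h R\<close> just before \<open>R\<close>. Comparing values of \<open>h\<close> avoids any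
    claim about the limit of \<open>f'\<close> at \<open>R\<close>.\<close>
  have flux: "a ^ 3 * f' a < 1" if a: "a \<in> {1<..<R}" for a
  proof (rule ccontr)
    assume "\<not> a ^ 3 * f' a < 1"
    then have ge: "f' b - 1 / b ^ 3 \<ge> 0" if "a \<le> b" "b < R" for b
      using mono[of a b] that a by (simp add: field_simps)
    have h_le: "h b \<le> h R" if "a \<le> b" "b < R" for b
    proof (rule DERIV_nonneg_imp_increasing_open[where f = h])
      show "continuous_on {b..R} h" using h_cont that a by simp
      show "\<exists>y. DERIV h x :> y \<and> 0 \<le> y" if "b < x" "x < R" for x
        using h'[of x] ge[of x] that \<open>a \<le> b\<close> a by auto
    qed (use that in simp)
    have "(h has_real_derivative D - 1 / R ^ 3) (at_left R)"
      unfolding h_def using a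
      by (auto intro!: derivative_eq_intros D
          simp: field_simps power2_eq_square power3_eq_cube)
    then obtain d where "d > 0"
      and d: "\<And>k. \<lbrakk>0 < k; R - k \<in> {..<R}; k < d\<rbrakk> \<Longrightarrow> h R < h (R - k)"
      using has_real_derivative_neg_dec_left[of h "D - 1 / R ^ 3" R "{..<R}"] D_less by auto
    define k where "k = min (d / 2) (R - a)"
    have "h R < h (R - k)" using d[of k] \<open>d > 0\<close> a by (simp add: k_def min_def)
    moreover have "h (R - k) \<le> h R" using h_le[of "R - k"] \<open>d > 0\<close> a by (simp add: k_def min_def)
    ultimately show False by simp
  qed
  have "h r > h R"
  proof (rule DERIV_neg_imp_decreasing_open[where f = h])
    show "continuous_on {r..R} h" using h_cont r by simp
    show "\<exists>y. DERIV h x :> y \<and> y < 0" if "r < x" "x < R" for x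
      using h'[of x] flux[of x] that r by (auto simp: field_simps)
  qed (use r in simp)
  then have "0 < f r + (1 / (2 * r\<^sup>2) - 1 / (2 * R\<^sup>2))"
    by (simp add: fR h_def diff_divide_distrib mult.commute)
  moreover have "1 / (2 * R\<^sup>2) > 0" using r by simp
  ultimately show ?thesis by linarith
qed

text \<open>Only one inequality is proved; exchanging the solutions gives the other. If it fails,
  \<open>z\<close> has a positive maximum, interior because \<open>z\<close> vanishes at both ends,
  and there z'' would be positive.\<close>

lemma radial_solution_le:
  assumes f: "radial_solution R s f" and g: "radial_solution R s g" and r: "r \<in> {1..R}"
  shows "f r \<le> g r"
proof (rule ccontr)
  assume neg: "\<not> f r \<le> g r"
  obtain f' where f_cont: "continuous_on {1..R} f" and f_bd: "f 1 = s" "f R = 0"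
    and f': "\<And>r. r \<in> {1<..<R} \<Longrightarrow> (f has_real_derivative f' r) (at r)"
    and f'': "\<And>r. r \<in> {1<..<R} \<Longrightarrow> (f' has_real_derivative (f r)\<^sup>2 - 3 / r * f' r) (at r)"
    using f unfolding radial_solution_def by metis
  obtain g' where g_cont: "continuous_on {1..R} g" and g_bd: "g 1 = s" "g R = 0"
    and g': "\<And>r. r \<in> {1<..<R} \<Longrightarrow> (g has_real_derivative g' r) (at r)"
    and g'': "\<And>r. r \<in> {1<..<R} \<Longrightarrow> (g' has_real_derivative (g r)\<^sup>2 - 3 / r * g' r) (at r)"
    using g unfolding radial_solution_def by metis
  \<comment> \<open>The plain difference f - g has zeroth-order coefficient f + g, which may be
    negative. The weight x = x^((d-2)/2) with d = 4 adds exactly 1/x^2.\<close>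
  define z where "z x = x * (f x - g x)" for x
  define z' where "z' x = f x - g x + x * (f' x - g' x)" for x
  have z': "(z has_real_derivative z' x) (at x)" if "x \<in> {1<..<R}" for x
    unfolding z_def z'_def using that
    by (auto intro!: derivative_eq_intros f' g')
  have z'': "(z' has_real_derivative (1 / x\<^sup>2 + f x + g x) * z x - z' x / x) (at x)"
    if "x \<in> {1<..<R}" for x
    unfolding z'_def using that
    by (auto intro!: derivative_eq_intros f' g' f'' g''
        simp: z_def field_simps power2_eq_square)
  have "continuous_on {1..R} z"
    unfolding z_def by (intro continuous_intros f_cont g_cont)
  then obtain m where m: "m \<in> {1..R}" and max: "\<And>x. x \<in> {1..R} \<Longrightarrow> z x \<le> z m"
    using continuous_attains_sup[of "{1..R}" z] r by (metis compact_Icc empty_iff)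
  have "0 < z r" using neg r by (simp add: z_def)
  then have zm: "z m > 0" using max[OF r] by simp
  have "m \<noteq> 1" "m \<noteq> R" using zm f_bd g_bd by (auto simp: z_def)
  with m have m: "m \<in> {1<..<R}" by auto
  define d where "d = min (m - 1) (R - m)"
  have d: "d > 0" using m by (simp add: d_def)
  have "z' m = 0"
    by (rule DERIV_local_max[OF z'[OF m] d]) (auto intro!: max simp: d_def)
  \<comment> \<open>Each solution lies strictly above -1/(2 m^2), so the two bounds together just
    offset 1/m^2.\<close>
  moreover have "1 / m\<^sup>2 + f m + g m > 0"
    using radial_solution_lower_bound[OF f m] radial_solution_lower_bound[OF g m] by simp
  ultimately have "(z' has_real_derivative (1 / m\<^sup>2 + f m + g m) * z m) (at m)"
    "(1 / m\<^sup>2 + f m + g m) * z m > 0"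
    using z''[OF m] zm by simp_all
  \<comment> \<open>Since \<open>z' m = 0\<close> and z' has positive derivative at
    \<open>m\<close>, z' is positive just to the right of \<open>m\<close>. So \<open>z\<close>
    rises above its maximum; the sign of z'' at the single point \<open>m\<close> suffices.\<close>
  from has_real_derivative_pos_inc_right[OF this] obtain e where e: "e > 0"
    and pos: "\<And>k. \<lbrakk>0 < k; k < e\<rbrakk> \<Longrightarrow> z' m < z' (m + k)"
    by auto
  define k where "k = min (e / 2) (d / 2)"
  have k: "0 < k" "k < e" "k < d" using e d by (auto simp: k_def)
  have "z m < z (m + k)"
  proof (rule DERIV_pos_imp_increasing_open[where f = z])
    show "\<exists>y. DERIV z x :> y \<and> 0 < y" if "m < x" "x < m + k" for x
      using z'[of x] pos[of "x - m"] \<open>z' m = 0\<close> that k m by (auto simp: d_def)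
    show "continuous_on {m..m + k} z"
      by (rule continuous_on_subset[OF \<open>continuous_on {1..R} z\<close>]) (use k m in \<open>auto simp: d_def\<close>)
  qed (use k in simp)
  moreover have "z (m + k) \<le> z m" by (rule max) (use k m in \<open>auto simp: d_def\<close>)
  ultimately show False by simp
qed

section \<open>From rotationally invariant solutions to radial profiles\<close>

lemma open_annulus_eq: "open_annulus R = {x. 1 < norm x \<and> norm x < R}"
  by (auto simp: open_annulus_def)

lemma open_open_annulus: "open (open_annulus R)"
  unfolding open_annulus_def by (intro open_Diff) auto

lemma closed_annulus_eq:
  assumes "R > 1"
  shows "closed_annulus R = {x. 1 \<le> norm x \<and> norm x \<le> R}"
proof
  have "closed {x::real^4. 1 \<le> norm x \<and> norm x \<le> R}"
    by (intro closed_Collect_conj closed_Collect_le continuous_intros)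
  then show "closed_annulus R \<subseteq> {x. 1 \<le> norm x \<and> norm x \<le> R}"
    unfolding closed_annulus_def open_annulus_eq by (rule closure_minimal[rotated]) auto
  show "{x. 1 \<le> norm x \<and> norm x \<le> R} \<subseteq> closed_annulus R"
  proof clarify
    fix x :: "real^4" assume x: "1 \<le> norm x" "norm x \<le> R"
    \<comment> \<open>The open radial segment in direction \<open>sgn x\<close> lies in the annulus;
      by continuity its closure, which contains \<open>x\<close>, lies in the closed
      annulus.\<close>
    have "(\<lambda>r. r *\<^sub>R sgn x) ` closure {1<..<R} \<subseteq> closed_annulus R"
    proof (rule image_closure_subset)
      show "(\<lambda>r. r *\<^sub>R sgn x) ` {1<..<R} \<subseteq> closed_annulus R"
        unfolding closed_annulus_def
        by (rule subset_trans[OF _ closure_subset]) (use x in \<open>auto simp: open_annulus_eq norm_sgn\<close>)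
    qed (auto intro!: continuous_intros simp: closed_annulus_def)
    moreover have "norm x *\<^sub>R sgn x = x"
      using x by (cases "x = 0") (auto simp: sgn_div_norm)
    moreover have "norm x \<in> closure {1<..<R}"
      using x assms by (simp add: closure_greaterThanLessThan)
    ultimately show "x \<in> closed_annulus R" by (metis image_subset_iff)
  qed
qed

text \<open>Rotations have determinant 1, and they act transitively on spheres about 0 once the
  dimension is at least 2; in dimension 1 only the identity is available.\<close>

lemma rotationally_invariant_on_eq_norm:
  fixes v :: "real^'n \<Rightarrow> real"
  assumes "2 \<le> CARD('n)" and "rotationally_invariant_on v S"
    and "x \<in> S" and "norm x = norm y"
  shows "v y = v x"
proof -
  obtain f where f: "orthogonal_transformation f" "det (matrix f) = 1" "f x = y"
    using rotation_exists[OF assms(1,4)] by blast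
  then have "rotation_matrix (matrix f)" "matrix f *v x = y"
    by (auto simp: rotation_matrix_def orthogonal_transformation_matrix)
  then show ?thesis
    using assms(2,3) unfolding rotationally_invariant_on_def by blast
qed

text \<open>The ray runs along a basis vector because \<open>C2_on\<close> speaks of derivatives in
  basis directions only: along it, \<open>partial_deriv e\<close> is the derivative of the
  profile.\<close>

lemma radial_solution_profile:
  fixes v :: "real^4 \<Rightarrow> real"
  assumes R: "R > 1" and sol: "is_solution R s v"
    and rot: "rotationally_invariant_on v (closed_annulus R)"
    and e: "e \<in> Basis"
  shows "radial_solution R s (\<lambda>r. v (r *\<^sub>R e))"
proof -
  define f where "f r = v (r *\<^sub>R e)" for r
  define f' where "f' r = partial_deriv e v (r *\<^sub>R e)" for r
  have ne: "norm e = 1" using e by simp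
  have in_open: "r *\<^sub>R e \<in> open_annulus R" if "r \<in> {1<..<R}" for r
    using that ne by (simp add: open_annulus_eq)
  have v: "v x = f (norm x)" if "x \<in> open_annulus R" for x
    unfolding f_def
    by (rule rotationally_invariant_on_eq_norm[OF _ rot])
      (use that ne R in \<open>auto simp: closed_annulus_eq open_annulus_eq\<close>)
  have line: "((\<lambda>r. u (r *\<^sub>R e)) has_real_derivative partial_deriv e u (r *\<^sub>R e)) (at r)"
    if "C1_on u (open_annulus R)" "r \<in> {1<..<R}" for u r
  proof -
    have "(\<lambda>t. u (r *\<^sub>R e + t *\<^sub>R e)) differentiable (at 0)"
      using that e in_open unfolding C1_on_def by blast
    then have "((\<lambda>t. u (r *\<^sub>R e + t *\<^sub>R e)) has_real_derivative
        partial_deriv e u (r *\<^sub>R e)) (at 0)"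
      unfolding partial_deriv_def by (simp add: DERIV_deriv_iff_real_differentiable)
    then show ?thesis
      using DERIV_shift[of "\<lambda>r. u (r *\<^sub>R e)" _ 0 r] by (simp add: scaleR_add_left add.commute)
  qed
  have C1: "C1_on v (open_annulus R)" "C1_on (partial_deriv e v) (open_annulus R)"
    using sol e unfolding is_solution_def C2_on_def by auto
  have der: "(f has_real_derivative f' r) (at r)" if "r \<in> {1<..<R}" for r
    using line[OF C1(1) that] by (simp add: f_def[abs_def] f'_def)
  have der2: "(f' has_real_derivative (f r)\<^sup>2 - 3 / r * f' r) (at r)" if r: "r \<in> {1<..<R}" for r
  proof -
    \<comment> \<open>Regularity provides some second derivative \<open>c\<close>; equating the
      radial Laplacian with the right-hand side of the PDE determines its value.\<close>
    obtain c where c: "(f' has_real_derivative c) (at r)"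
      using line[OF C1(2) r] unfolding f'_def by blast
    have nr: "norm (r *\<^sub>R e) = r" using r ne by simp
    have "laplacian v (r *\<^sub>R e) = c + (DIM(real^4) - 1) / norm (r *\<^sub>R e) * f' (norm (r *\<^sub>R e))"
    proof (rule laplacian_radial[OF open_open_annulus in_open[OF r]])
      show "(f has_real_derivative f' (norm y)) (at (norm y))" if "y \<in> open_annulus R" for y
        using der that by (simp add: open_annulus_eq)
    qed (use v c nr in \<open>auto simp: open_annulus_eq\<close>)
    moreover have "laplacian v (r *\<^sub>R e) = (f r)\<^sup>2"
      using sol in_open[OF r] unfolding is_solution_def f_def by blast
    ultimately have "c = (f r)\<^sup>2 - 3 / r * f' r" using nr by simp
    with c show ?thesis by simp
  qed
  have "continuous_on {1..R} f"
    unfolding f_def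
  proof (rule continuous_on_compose2[where g = v])
    show "continuous_on (closed_annulus R) v" using sol by (simp add: is_solution_def)
    show "continuous_on {1..R} (\<lambda>r. r *\<^sub>R e)" by (intro continuous_intros)
    show "(\<lambda>r. r *\<^sub>R e) ` {1..R} \<subseteq> closed_annulus R"
      using R ne by (auto simp: closed_annulus_eq)
  qed
  moreover have "f 1 = s" "f R = 0"
    using sol R ne by (auto simp: is_solution_def f_def)
  moreover obtain D where D: "has_normal_derivative v D (R *\<^sub>R e)" "\<bar>D\<bar> < 1 / R ^ 3"
  proof -
    have "R *\<^sub>R e \<in> sphere 0 R" using R ne by simp
    then show ?thesis using sol that unfolding is_solution_def by blast
  qed
  moreover have "(f has_real_derivative D) (at_left R)"
  proof -
    have "sgn (R *\<^sub>R e) = e" using R ne by (simp add: sgn_div_norm)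
    then have "((\<lambda>t. f (R + t)) has_real_derivative D) (at_left 0)"
      using D(1) by (simp add: has_normal_derivative_def f_def scaleR_add_left)
    \<comment> \<open>The shift \<open>r - R\<close> carries the left side of \<open>R\<close> into
      the left side of 0, so the chain rule turns the normal derivative into the left derivative of
      the profile.\<close>
    moreover have "(\<lambda>r. r - R) ` {..<R} \<subseteq> {..<0}" by auto
    ultimately have "((\<lambda>t. f (R + t)) has_real_derivative D)
        (at (R - R) within (\<lambda>r. r - R) ` {..<R})"
      using DERIV_subset by fastforce
    moreover have "((\<lambda>r. r - R) has_real_derivative 1) (at_left R)"
      by (auto intro!: derivative_eq_intros)
    ultimately show ?thesis
      using DERIV_image_chain[of "\<lambda>t. f (R + t)" D "\<lambda>r. r - R" R "{..<R}" 1]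
      by (simp add: o_def)
  qed
  ultimately show ?thesis
    using der der2 unfolding radial_solution_def f_def[symmetric] by blast
qed

theorem theorem1p12:
  fixes R s :: real and v w :: "real^4 \<Rightarrow> real"
  assumes "R > 1" and "s < 0"
    and "is_solution R s v" and "rotationally_invariant_on v (closed_annulus R)"
    and "is_solution R s w" and "rotationally_invariant_on w (closed_annulus R)"
  shows "\<forall>x\<in>closed_annulus R. v x = w x"
proof
  fix x assume x: "x \<in> closed_annulus R"
  obtain e :: "real^4" where e: "e \<in> Basis" using nonempty_Basis by blast
  \<comment> \<open>\<open>y\<close> is the point of the chosen ray on the sphere through
    \<open>x\<close>; invariance moves the comparison there.\<close>
  define y where "y = norm x *\<^sub>R e"
  have y: "norm x = norm y" "norm x \<in> {1..R}"
    using e x \<open>R > 1\<close> by (auto simp: y_def closed_annulus_eq)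
  have "v y = v x" "w y = w x"
    by (rule rotationally_invariant_on_eq_norm[OF _ _ x y(1)]; use assms in simp)+
  moreover have "v y = w y"
  proof -
    note V = radial_solution_profile[OF assms(1,3,4) e] and W = radial_solution_profile[OF assms(1,5,6) e]
    show ?thesis
    unfolding y_def
    using radial_solution_le[OF V W y(2)] radial_solution_le[OF W V y(2)] by (rule antisym)
  qed
  ultimately show "v x = w x" by simp
qed

end
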